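(* Let $I$ be a two-sided ideal in a $C^*$-algebra $A$. Then the following hold: (1) If $I$ is semiprime, then $T(I)$ is a semiprime Lie ideal in $A$. (2) If $I$ is prime and $A/I$ is nonabelian (that is, not commutative), then $T(I)$ is a prime Lie ideal in $A$.
   Context: A $C^*$-algebra $A$ need not be unital. For $a,b\in A$ put $[a,b]:=ab-ba$; for subsets $E,F\subseteq A$, $[E,F]$ denotes the linear span of $\{[a,b]:a\in E,b\in F\}$. A two-sided ideal in $A$ is a linear subspace $I\subseteq A$ (not necessarily closed) with $ax,xa\in I$ for all $a\in A$, $x\in I$. A two-sided ideal $I$ is prime if $I\neq A$ and, for all two-sided ideals $I_1,I_2$, $I_1I_2\subseteq I$ implies $I_1\subseteq I$ or $I_2\subseteq I$; it is semiprime if for every two-sided ideal $J$, $J^2\subseteq I$ implies $J\subseteq I$ (equivalently, $I$ is an intersection of prime ideals, with $A$ itself being the empty intersection). A Lie ideal in $A$ is a linear subspace $L\subseteq A$ (not necessarily closed) with $[A,L]\subseteq L$. A Lie ideal $L$ is prime if $L\neq A$ and, for all Lie ideals $K_1,K_2\subseteq A$ with $[K_1,K_2]\subseteq L$, one has $K_1\subseteq L$ or $K_2\subseteq L$. A Lie ideal $L$ is semiprime if for every Lie ideal $K\subseteq A$ with $[K,K]\subseteq L$ one has $K\subseteq L$. For a linear subspace $L\subseteq A$, the full normalizer subspace is $T(L):=\{a\in A:[A,a]\subseteq L\}$. *)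

theory Defs
  imports Complex_Main
begin

text \<open>
  The algebra is the whole type. No unit is assumed, and the zero algebra is allowed. The real
  scalar multiplication inherited from the class of real normed algebras is required to be the
  restriction of the complex one.
\<close>

class cstar_algebra = real_normed_algebra + banach +
  fixes scaleC :: "complex \<Rightarrow> 'a \<Rightarrow> 'a"  (infixr "*\<^sub>C" 75)
    and star :: "'a \<Rightarrow> 'a"
  assumes scaleR_eq_scaleC: "r *\<^sub>R x = complex_of_real r *\<^sub>C x"
    and scaleC_add_right: "c *\<^sub>C (x + y) = c *\<^sub>C x + c *\<^sub>C y"
    and scaleC_add_left: "(c + d) *\<^sub>C x = c *\<^sub>C x + d *\<^sub>C x"
    and scaleC_scaleC: "c *\<^sub>C (d *\<^sub>C x) = (c * d) *\<^sub>C x"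
    and scaleC_one: "1 *\<^sub>C x = x"
    and mult_scaleC_left: "(c *\<^sub>C x) * y = c *\<^sub>C (x * y)"
    and mult_scaleC_right: "x * (c *\<^sub>C y) = c *\<^sub>C (x * y)"
    and norm_scaleC: "norm (c *\<^sub>C x) = cmod c * norm x"
    and star_add: "star (x + y) = star x + star y"
    and star_scaleC: "star (c *\<^sub>C x) = cnj c *\<^sub>C star x"
    and star_mult: "star (x * y) = star y * star x"
    and star_star: "star (star x) = x"
    and cstar_identity: "norm (star x * x) = (norm x)\<^sup>2"

global_interpretation complex_vector:
  vector_space "scaleC :: complex \<Rightarrow> 'a \<Rightarrow> 'a::cstar_algebra"
  by unfold_locales (rule scaleC_add_right scaleC_add_left scaleC_scaleC scaleC_one)+

definition commutator :: "'a::cstar_algebra \<Rightarrow> 'a \<Rightarrow> 'a" where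
  "commutator a b = a * b - b * a"

definition commutator_span :: "'a::cstar_algebra set \<Rightarrow> 'a set \<Rightarrow> 'a set" where
  "commutator_span E F = complex_vector.span {commutator a b | a b. a \<in> E \<and> b \<in> F}"

definition product_span :: "'a::cstar_algebra set \<Rightarrow> 'a set \<Rightarrow> 'a set" where
  "product_span E F = complex_vector.span {a * b | a b. a \<in> E \<and> b \<in> F}"

text \<open>Ideals and Lie ideals are complex linear subspaces; they are not assumed to be closed.\<close>

definition two_sided_ideal :: "'a::cstar_algebra set \<Rightarrow> bool" where
  "two_sided_ideal I \<longleftrightarrow>
     complex_vector.subspace I \<and> (\<forall>a. \<forall>x\<in>I. a * x \<in> I \<and> x * a \<in> I)"

definition prime_two_sided_ideal :: "'a::cstar_algebra set \<Rightarrow> bool" where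
  "prime_two_sided_ideal I \<longleftrightarrow>
     two_sided_ideal I \<and> I \<noteq> UNIV \<and>
     (\<forall>I1 I2. two_sided_ideal I1 \<longrightarrow> two_sided_ideal I2 \<longrightarrow>
        product_span I1 I2 \<subseteq> I \<longrightarrow> I1 \<subseteq> I \<or> I2 \<subseteq> I)"

definition semiprime_two_sided_ideal :: "'a::cstar_algebra set \<Rightarrow> bool" where
  "semiprime_two_sided_ideal I \<longleftrightarrow>
     two_sided_ideal I \<and>
     (\<forall>J. two_sided_ideal J \<longrightarrow> product_span J J \<subseteq> I \<longrightarrow> J \<subseteq> I)"

definition lie_ideal :: "'a::cstar_algebra set \<Rightarrow> bool" where
  "lie_ideal L \<longleftrightarrow> complex_vector.subspace L \<and> commutator_span UNIV L \<subseteq> L"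

definition prime_lie_ideal :: "'a::cstar_algebra set \<Rightarrow> bool" where
  "prime_lie_ideal L \<longleftrightarrow>
     lie_ideal L \<and> L \<noteq> UNIV \<and>
     (\<forall>K1 K2. lie_ideal K1 \<longrightarrow> lie_ideal K2 \<longrightarrow>
        commutator_span K1 K2 \<subseteq> L \<longrightarrow> K1 \<subseteq> L \<or> K2 \<subseteq> L)"

definition semiprime_lie_ideal :: "'a::cstar_algebra set \<Rightarrow> bool" where
  "semiprime_lie_ideal L \<longleftrightarrow>
     lie_ideal L \<and>
     (\<forall>K. lie_ideal K \<longrightarrow> commutator_span K K \<subseteq> L \<longrightarrow> K \<subseteq> L)"

definition full_normalizer :: "'a::cstar_algebra set \<Rightarrow> 'a set" where
  "full_normalizer L = {a. commutator_span UNIV {a} \<subseteq> L}"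

definition coset :: "'a::cstar_algebra set \<Rightarrow> 'a \<Rightarrow> 'a set" where
  "coset I a = {a + x | x. x \<in> I}"

definition quotient_carrier :: "'a::cstar_algebra set \<Rightarrow> 'a set set" where
  "quotient_carrier I = range (coset I)"

text \<open>
  For a two-sided ideal, all the cosets in the union below coincide, so that the product of the
  cosets of \<open>a\<close> and \<open>b\<close> is the coset of \<open>a * b\<close>; see \<open>quotient_mult_coset\<close>.
\<close>

definition quotient_mult :: "'a::cstar_algebra set \<Rightarrow> 'a set \<Rightarrow> 'a set \<Rightarrow> 'a set" where
  "quotient_mult I S T = (\<Union>s\<in>S. \<Union>t\<in>T. coset I (s * t))"

definition quotient_abelian :: "'a::cstar_algebra set \<Rightarrow> bool" where
  "quotient_abelian I \<longleftrightarrow>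
     (\<forall>S\<in>quotient_carrier I. \<forall>T\<in>quotient_carrier I. quotient_mult I S T = quotient_mult I T S)"

lemma quotient_mult_coset:
  assumes "two_sided_ideal I"
  shows "quotient_mult I (coset I a) (coset I b) = coset I (a * b)"
proof -
  have sub: "complex_vector.subspace I"
    and l: "\<And>c x. x \<in> I \<Longrightarrow> c * x \<in> I" and r: "\<And>c x. x \<in> I \<Longrightarrow> x * c \<in> I"
    using assms by (auto simp: two_sided_ideal_def)
  have zero: "0 \<in> I" using sub by (rule complex_vector.subspace_0)
  have add: "\<And>x y. x \<in> I \<Longrightarrow> y \<in> I \<Longrightarrow> x + y \<in> I"
    using sub by (rule complex_vector.subspace_add)
  show ?thesis
  proof
    show "quotient_mult I (coset I a) (coset I b) \<subseteq> coset I (a * b)"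
    proof
      fix z assume "z \<in> quotient_mult I (coset I a) (coset I b)"
      then obtain x y w where m: "x \<in> I" "y \<in> I" "w \<in> I" and z: "z = (a + x) * (b + y) + w"
        by (auto simp: quotient_mult_def coset_def)
      have "z = a * b + (a * y + x * (b + y) + w)"
        by (simp add: z algebra_simps)
      moreover have "a * y + x * (b + y) + w \<in> I"
        using m by (intro add l r)
      ultimately show "z \<in> coset I (a * b)"
        by (auto simp: coset_def)
    qed
    have "c \<in> coset I c" for c
      using zero by (force simp: coset_def)
    then show "coset I (a * b) \<subseteq> quotient_mult I (coset I a) (coset I b)"
      unfolding quotient_mult_def by blast
  qed
qed

end

theory Submission
  imports Defs
begin

text \<open>
  The statement is purely algebraic: \<open>T(I)\<close> is the preimage of the centre of \<open>R = A/I\<close>, so the claim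
  is about Lie ideals of a (semi)prime algebra \<open>R\<close> whose commutators are central. All computations
  are carried out in \<open>A\<close> modulo \<open>I\<close>, following Herstein's method.

  Let \<open>d = [a, \<cdot>]\<close>. If \<open>d\<^sup>2 = 0\<close>, then the Leibniz rule gives \<open>2 d(x) d(y) = 0\<close>, and therefore
  \<open>d(x) y d(x) = 0\<close>; semiprimeness yields \<open>d = 0\<close> (\<open>square_zero_inner_derivation\<close>).
  If \<open>d\<^sup>2\<close> only has central values, then \<open>d\<^sup>2(x) a = d\<^sup>2(x a)\<close> is central as well, so \<open>d\<^sup>2(x)\<close>
  annihilates all values of \<open>d\<close>, in particular itself; a central element of square zero vanishes, and
  the first case applies (\<open>central_square_inner_derivation\<close>). For a Lie ideal \<open>K\<close> with \<open>[K,K]\<close>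
  central, this applies to each \<open>a \<in> K\<close>, which gives the semiprime part.

  Now let \<open>R\<close> be prime and \<open>[K\<^sub>1,K\<^sub>2]\<close> central. For \<open>a \<in> K\<^sub>1\<close> and \<open>b \<in> K\<^sub>2\<close>, the elements
  \<open>b [b,x] = [b, b x]\<close> also lie in \<open>K\<^sub>2\<close>, and this forces \<open>[a,b] [b,[b,x]] = 0\<close>. Primeness and the
  first case give \<open>[a,b] = 0\<close> (\<open>commutator_vanishes_if_central\<close>), so the composition of
  \<open>[a, \<cdot>]\<close> with \<open>[b, \<cdot>]\<close> vanishes. In the spirit of Posner's theorem on products of derivations,
  one of \<open>a\<close> and \<open>b\<close> is then central (\<open>composition_zero_inner_derivations\<close>), and hence so is one
  of the two Lie ideals: if some \<open>a \<in> K\<^sub>1\<close> is not central, then every \<open>b \<in> K\<^sub>2\<close> is. That \<open>R\<close> is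
  not commutative says exactly that \<open>T(I)\<close> is a proper subspace.
\<close>

section \<open>Ideals and commutators\<close>

lemma ideal_closed:
  assumes "two_sided_ideal I"
  shows ideal_zero: "0 \<in> I"
    and ideal_add: "x \<in> I \<Longrightarrow> y \<in> I \<Longrightarrow> x + y \<in> I"
    and ideal_diff: "x \<in> I \<Longrightarrow> y \<in> I \<Longrightarrow> x - y \<in> I"
    and ideal_neg: "x \<in> I \<Longrightarrow> - x \<in> I"
    and ideal_scale: "x \<in> I \<Longrightarrow> c *\<^sub>C x \<in> I"
    and ideal_mult_left: "x \<in> I \<Longrightarrow> a * x \<in> I"
    and ideal_mult_right: "x \<in> I \<Longrightarrow> x * a \<in> I"
  using assms unfolding two_sided_ideal_def
  by (auto intro: complex_vector.subspace_0 complex_vector.subspace_add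
      complex_vector.subspace_diff complex_vector.subspace_neg complex_vector.subspace_scale)

lemma two_sided_idealI:
  assumes "0 \<in> I" "\<And>x y. x \<in> I \<Longrightarrow> y \<in> I \<Longrightarrow> x + y \<in> I" "\<And>c x. x \<in> I \<Longrightarrow> c *\<^sub>C x \<in> I"
    "\<And>a x. x \<in> I \<Longrightarrow> a * x \<in> I" "\<And>a x. x \<in> I \<Longrightarrow> x * a \<in> I"
  shows "two_sided_ideal I"
  using assms by (simp add: two_sided_ideal_def complex_vector.subspace_def)

lemma ideal_half:
  assumes "two_sided_ideal I" "x + x \<in> I"
  shows "x \<in> I"
proof -
  have "(1/2) *\<^sub>C (x + x) = x"
    using scaleC_add_left[of "1/2" "1/2" x] by (simp add: scaleC_add_right scaleC_one)
  with ideal_scale[OF assms, of "1/2"] show ?thesis by simp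
qed

lemma product_span_subsetI:
  assumes "two_sided_ideal I" "\<And>x y. x \<in> E \<Longrightarrow> y \<in> F \<Longrightarrow> x * y \<in> I"
  shows "product_span E F \<subseteq> I"
  unfolding product_span_def
  by (rule complex_vector.span_minimal) (use assms in \<open>auto simp: two_sided_ideal_def\<close>)

lemma commutator_span_base:
  "x \<in> E \<Longrightarrow> y \<in> F \<Longrightarrow> commutator x y \<in> commutator_span E F"
  unfolding commutator_span_def by (blast intro: complex_vector.span_base)

lemma commutator_minus_swap: "commutator x y = - commutator y x"
  by (simp add: commutator_def)

lemma commutator_ideal_swap:
  assumes "two_sided_ideal I" "commutator x y \<in> I"
  shows "commutator y x \<in> I"
  using ideal_neg[OF assms] by (simp add: commutator_minus_swap[of y x])

lemma commutator_mult_right: "commutator a (x * y) = commutator a x * y + x * commutator a y"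
  by (simp add: commutator_def algebra_simps)

lemma commutator_in_ideal:
  assumes "two_sided_ideal I" "x \<in> I"
  shows "commutator y x \<in> I"
  using assms unfolding commutator_def by (intro ideal_diff ideal_mult_left ideal_mult_right)

section \<open>Elementwise primeness without a unit\<close>

lemma left_annihilator_ideal:
  assumes I: "two_sided_ideal I"
  shows "two_sided_ideal {u. \<forall>r. u * r * y \<in> I}"
proof (rule two_sided_idealI; clarsimp)
  show "0 \<in> I" by (rule ideal_zero[OF I])
next
  fix u v r assume "\<forall>r. u * r * y \<in> I" "\<forall>r. v * r * y \<in> I"
  then show "(u + v) * r * y \<in> I"
    by (simp add: distrib_right ideal_add[OF I])
next
  fix c u r assume "\<forall>r. u * r * y \<in> I"
  then show "(c *\<^sub>C u) * r * y \<in> I"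
    by (simp add: mult_scaleC_left ideal_scale[OF I])
next
  fix a u r assume "\<forall>r. u * r * y \<in> I"
  then show "a * u * r * y \<in> I"
    using ideal_mult_left[OF I, of "u * r * y" a] by (simp add: mult.assoc)
next
  fix a u r assume "\<forall>r. u * r * y \<in> I"
  then have "u * (a * r) * y \<in> I" by blast
  then show "u * a * r * y \<in> I" by (simp add: mult.assoc)
qed

lemma right_annihilator_ideal:
  assumes I: "two_sided_ideal I" and J: "two_sided_ideal J"
  shows "two_sided_ideal {v. \<forall>u\<in>J. u * v \<in> I}"
proof (rule two_sided_idealI; clarsimp)
  show "0 \<in> I" by (rule ideal_zero[OF I])
next
  fix v w u assume "\<forall>u\<in>J. u * v \<in> I" "\<forall>u\<in>J. u * w \<in> I" "u \<in> J"
  then show "u * (v + w) \<in> I"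
    by (simp add: distrib_left ideal_add[OF I])
next
  fix c v u assume "\<forall>u\<in>J. u * v \<in> I" "u \<in> J"
  then show "u * (c *\<^sub>C v) \<in> I"
    by (simp add: mult_scaleC_right ideal_scale[OF I])
next
  fix a v u assume "\<forall>u\<in>J. u * v \<in> I" "u \<in> J"
  then have "(u * a) * v \<in> I" by (blast intro: ideal_mult_right[OF J])
  then show "u * (a * v) \<in> I" by (simp add: mult.assoc)
next
  fix a v u assume "\<forall>u\<in>J. u * v \<in> I" "u \<in> J"
  then show "u * (v * a) \<in> I"
    using ideal_mult_right[OF I, of "u * v" a] by (simp add: mult.assoc)
qed

text \<open>
  Without a unit, \<open>x\<close> need not lie in \<open>A x A\<close>, so arguments with the products \<open>r x\<close> show only
  \<open>A x \<subseteq> I\<close> at first. This suffices because the elements with this property form a two-sided ideal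
  whose square lies in \<open>I\<close>.
\<close>

lemma semiprime_absorbs_left_annihilated:
  fixes I :: "'a::cstar_algebra set"
  assumes sp: "semiprime_two_sided_ideal I" and x: "\<And>r. r * x \<in> I"
  shows "x \<in> I"
proof -
  have I: "two_sided_ideal I"
    and sq: "\<And>J. two_sided_ideal J \<Longrightarrow> product_span J J \<subseteq> I \<Longrightarrow> J \<subseteq> I"
    using sp by (auto simp: semiprime_two_sided_ideal_def)
  have UNIV: "two_sided_ideal (UNIV :: 'a set)"
    by (rule two_sided_idealI) auto
  let ?N = "{v. \<forall>u\<in>UNIV. u * v \<in> I}"
  have "product_span ?N ?N \<subseteq> I"
    by (rule product_span_subsetI[OF I]) auto
  then have "?N \<subseteq> I"
    by (rule sq[OF right_annihilator_ideal[OF I UNIV]])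
  then show ?thesis using x by auto
qed

text \<open>
  Since \<open>J\<^sub>1 J\<^sub>2 \<subseteq> I\<close> for the ideals \<open>J\<^sub>1 = {u. u A x \<subseteq> I}\<close> and \<open>J\<^sub>2 = {v. J\<^sub>1 v \<subseteq> I}\<close>, their intersection
  squares into \<open>I\<close>. It contains \<open>A x\<close>, because \<open>x \<in> J\<^sub>1\<close> and \<open>A x \<subseteq> J\<^sub>2\<close>.
\<close>

lemma semiprime_elementwise:
  assumes sp: "semiprime_two_sided_ideal I" and x: "\<And>r. x * r * x \<in> I"
  shows "x \<in> I"
proof -
  have I: "two_sided_ideal I"
    and sq: "\<And>J. two_sided_ideal J \<Longrightarrow> product_span J J \<subseteq> I \<Longrightarrow> J \<subseteq> I"
    using sp by (auto simp: semiprime_two_sided_ideal_def)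
  define J1 where "J1 = {u. \<forall>r. u * r * x \<in> I}"
  define J2 where "J2 = {v. \<forall>u\<in>J1. u * v \<in> I}"
  have J1: "two_sided_ideal J1" unfolding J1_def by (rule left_annihilator_ideal[OF I])
  have J2: "two_sided_ideal J2" unfolding J2_def by (rule right_annihilator_ideal[OF I J1])
  have "two_sided_ideal (J1 \<inter> J2)"
    using J1 J2 by (auto simp: two_sided_ideal_def intro: complex_vector.subspace_inter)
  moreover have "product_span (J1 \<inter> J2) (J1 \<inter> J2) \<subseteq> I"
    by (rule product_span_subsetI[OF I]) (auto simp: J2_def)
  ultimately have sub: "J1 \<inter> J2 \<subseteq> I" by (rule sq)
  have "x \<in> J1" using x by (simp add: J1_def)
  then have "r * x \<in> J1" for r by (rule ideal_mult_left[OF J1])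
  moreover have "r * x \<in> J2" for r
    by (auto simp: J1_def J2_def mult.assoc)
  ultimately have "r * x \<in> I" for r using sub by blast
  then show ?thesis by (rule semiprime_absorbs_left_annihilated[OF sp])
qed

lemma prime_imp_semiprime:
  "prime_two_sided_ideal I \<Longrightarrow> semiprime_two_sided_ideal I"
  unfolding prime_two_sided_ideal_def semiprime_two_sided_ideal_def by blast

text \<open>
  The ideals \<open>J\<^sub>1 = {u. u A y \<subseteq> I}\<close>, which contains \<open>x\<close>, and \<open>J\<^sub>2 = {v. J\<^sub>1 v \<subseteq> I}\<close>, which contains \<open>A y\<close>,
  have product inside \<open>I\<close>, so one of them lies in \<open>I\<close>.
\<close>

lemma prime_elementwise:
  assumes p: "prime_two_sided_ideal I" and xy: "\<And>r. x * r * y \<in> I"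
  shows "x \<in> I \<or> y \<in> I"
proof -
  have I: "two_sided_ideal I"
    and pr: "\<And>J K. two_sided_ideal J \<Longrightarrow> two_sided_ideal K \<Longrightarrow> product_span J K \<subseteq> I
              \<Longrightarrow> J \<subseteq> I \<or> K \<subseteq> I"
    using p by (auto simp: prime_two_sided_ideal_def)
  define J1 where "J1 = {u. \<forall>r. u * r * y \<in> I}"
  define J2 where "J2 = {v. \<forall>u\<in>J1. u * v \<in> I}"
  have J1: "two_sided_ideal J1" unfolding J1_def by (rule left_annihilator_ideal[OF I])
  have J2: "two_sided_ideal J2" unfolding J2_def by (rule right_annihilator_ideal[OF I J1])
  have "product_span J1 J2 \<subseteq> I"
    by (rule product_span_subsetI[OF I]) (auto simp: J2_def)
  from pr[OF J1 J2 this] show ?thesis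
  proof
    assume "J1 \<subseteq> I"
    moreover have "x \<in> J1" using xy by (simp add: J1_def)
    ultimately show ?thesis by blast
  next
    assume "J2 \<subseteq> I"
    moreover have "r * y \<in> J2" for r
      by (auto simp: J1_def J2_def mult.assoc)
    ultimately have "r * y \<in> I" for r by blast
    then show ?thesis
      using semiprime_absorbs_left_annihilated[OF prime_imp_semiprime[OF p]] by blast
  qed
qed

section \<open>The full normalizer as the centre modulo the ideal\<close>

lemma mem_full_normalizer_iff:
  assumes "two_sided_ideal I"
  shows "a \<in> full_normalizer I \<longleftrightarrow> (\<forall>x. commutator a x \<in> I)"
proof
  assume "a \<in> full_normalizer I"
  then have "commutator x a \<in> I" for x
    using commutator_span_base[of x UNIV a "{a}"] by (auto simp: full_normalizer_def)
  then show "\<forall>x. commutator a x \<in> I"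
    using commutator_ideal_swap[OF assms] by blast
next
  assume "\<forall>x. commutator a x \<in> I"
  then have "{commutator x b | x b. x \<in> UNIV \<and> b \<in> {a}} \<subseteq> I"
    using commutator_ideal_swap[OF assms] by blast
  then show "a \<in> full_normalizer I"
    using assms unfolding full_normalizer_def commutator_span_def two_sided_ideal_def
    by (auto dest: complex_vector.span_minimal)
qed

lemma full_normalizer_commutes:
  assumes "two_sided_ideal I" "z \<in> full_normalizer I"
  shows "commutator z x \<in> I" and "commutator x z \<in> I"
  using assms mem_full_normalizer_iff commutator_ideal_swap by blast+

lemma ideal_subset_full_normalizer:
  assumes "two_sided_ideal I"
  shows "I \<subseteq> full_normalizer I"
  using mem_full_normalizer_iff[OF assms] commutator_in_ideal[OF assms]
    commutator_ideal_swap[OF assms] by blast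

lemma lie_ideal_full_normalizer:
  assumes I: "two_sided_ideal I"
  shows "lie_ideal (full_normalizer I)"
proof -
  have "complex_vector.subspace (full_normalizer I)"
  proof (rule complex_vector.subspaceI)
    show "0 \<in> full_normalizer I"
      using ideal_subset_full_normalizer[OF I] ideal_zero[OF I] by blast
  next
    fix x y assume *: "x \<in> full_normalizer I" "y \<in> full_normalizer I"
    have "commutator (x + y) z = commutator x z + commutator y z" for z
      by (simp add: commutator_def algebra_simps)
    with * show "x + y \<in> full_normalizer I"
      by (simp add: mem_full_normalizer_iff[OF I] ideal_add[OF I])
  next
    fix c x assume *: "x \<in> full_normalizer I"
    have "commutator (c *\<^sub>C x) z = c *\<^sub>C commutator x z" for z
      by (simp add: commutator_def mult_scaleC_left mult_scaleC_right
          complex_vector.scale_right_diff_distrib)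
    with * show "c *\<^sub>C x \<in> full_normalizer I"
      by (simp add: mem_full_normalizer_iff[OF I] ideal_scale[OF I])
  qed
  moreover from this have "commutator_span UNIV (full_normalizer I) \<subseteq> full_normalizer I"
    unfolding commutator_span_def
    using full_normalizer_commutes[OF I] ideal_subset_full_normalizer[OF I]
    by (intro complex_vector.span_minimal) auto
  ultimately show ?thesis by (simp add: lie_ideal_def)
qed

lemma lie_ideal_commutator:
  assumes "lie_ideal K" "b \<in> K"
  shows "commutator b x \<in> K"
proof -
  have "commutator x b \<in> K"
    using assms commutator_span_base[of x UNIV b K] by (auto simp: lie_ideal_def)
  then show ?thesis
    using assms by (auto simp: lie_ideal_def commutator_minus_swap[of b x]
        intro: complex_vector.subspace_neg)
qed

lemma full_normalizer_UNIV_imp_quotient_abelian: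
  assumes I: "two_sided_ideal I" and T: "full_normalizer I = UNIV"
  shows "quotient_abelian I"
proof -
  have sub: "coset I (a * b) \<subseteq> coset I (b * a)" for a b
  proof
    fix z assume "z \<in> coset I (a * b)"
    then obtain x where x: "x \<in> I" "z = a * b + x" by (auto simp: coset_def)
    have "commutator a b \<in> I" using full_normalizer_commutes[OF I] T by blast
    then have "commutator a b + x \<in> I" using x by (intro ideal_add[OF I])
    moreover have "z = b * a + (commutator a b + x)" using x by (simp add: commutator_def)
    ultimately show "z \<in> coset I (b * a)" by (auto simp: coset_def)
  qed
  have "coset I (a * b) = coset I (b * a)" for a b
    using sub[of a b] sub[of b a] by (rule subset_antisym)
  then show ?thesis
    by (auto simp: quotient_abelian_def quotient_carrier_def quotient_mult_coset[OF I])
qed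

text \<open>If \<open>c\<close> is central modulo \<open>I\<close>, then \<open>c r c\<close> agrees with \<open>r c\<^sup>2\<close> there.\<close>

lemma full_normalizer_square_zero:
  assumes sp: "semiprime_two_sided_ideal I" and c: "c \<in> full_normalizer I" "c * c \<in> I"
  shows "c \<in> I"
proof (rule semiprime_elementwise[OF sp])
  fix r
  have I: "two_sided_ideal I" using sp by (simp add: semiprime_two_sided_ideal_def)
  have "c * r * c = commutator c r * c + r * (c * c)"
    by (simp add: commutator_def algebra_simps)
  also have "\<dots> \<in> I"
    by (intro ideal_add[OF I] ideal_mult_left[OF I] ideal_mult_right[OF I] c
        full_normalizer_commutes(1)[OF I])
  finally show "c * r * c \<in> I" .
qed

section \<open>Inner derivations modulo a semiprime ideal\<close>

text \<open>
  If \<open>d\<^sup>2 = 0\<close> for a derivation \<open>d\<close>, then \<open>d\<^sup>2(x y) = 0\<close> leaves only the cross term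
  \<open>2 d(x) d(y)\<close>; putting \<open>y x\<close> for \<open>y\<close> in \<open>d(x) d(y) = 0\<close> gives \<open>d(x) y d(x) = 0\<close>.
\<close>

lemma square_zero_inner_derivation:
  assumes sp: "semiprime_two_sided_ideal I" and a: "\<And>x. commutator a (commutator a x) \<in> I"
  shows "a \<in> full_normalizer I"
proof -
  have I: "two_sided_ideal I" using sp by (simp add: semiprime_two_sided_ideal_def)
  let ?d = "commutator a"
  have cross: "?d x * ?d y \<in> I" for x y
  proof (rule ideal_half[OF I])
    have "?d x * ?d y + ?d x * ?d y = ?d (?d (x * y)) - ?d (?d x) * y - x * ?d (?d y)"
      by (simp add: commutator_def algebra_simps)
    also have "\<dots> \<in> I"
      by (intro ideal_diff[OF I] ideal_mult_left[OF I] ideal_mult_right[OF I] a)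
    finally show "?d x * ?d y + ?d x * ?d y \<in> I" .
  qed
  have "?d x \<in> I" for x
  proof (rule semiprime_elementwise[OF sp])
    fix y
    have "?d x * y * ?d x = ?d x * ?d (y * x) - ?d x * ?d y * x"
      by (simp add: commutator_mult_right algebra_simps)
    also have "\<dots> \<in> I"
      by (intro ideal_diff[OF I] ideal_mult_right[OF I] cross)
    finally show "?d x * y * ?d x \<in> I" .
  qed
  then show ?thesis by (simp add: mem_full_normalizer_iff[OF I])
qed

text \<open>
  Both \<open>w = d\<^sup>2(x)\<close> and \<open>w a = d\<^sup>2(x a)\<close> are central modulo \<open>I\<close>, so \<open>w [a,y] = [w a, y] = 0\<close> for all
  \<open>y\<close>. The choice \<open>y = d(x)\<close> makes the second factor \<open>w\<close> itself.
\<close>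

lemma central_square_inner_derivation:
  assumes sp: "semiprime_two_sided_ideal I"
    and a: "\<And>x. commutator a (commutator a x) \<in> full_normalizer I"
  shows "a \<in> full_normalizer I"
proof (rule square_zero_inner_derivation[OF sp])
  fix x
  have I: "two_sided_ideal I" using sp by (simp add: semiprime_two_sided_ideal_def)
  let ?d = "commutator a"
  let ?w = "?d (?d x)"
  have wa: "?d (?d (x * a)) = ?w * a"
    by (simp add: commutator_def algebra_simps)
  have "?w * ?w = commutator (?w * a) (?d x) - commutator ?w (?d x) * a"
    by (simp add: commutator_def algebra_simps)
  also have "\<dots> \<in> I"
    using a[of "x * a"] a[of x] unfolding wa
    by (intro ideal_diff[OF I] ideal_mult_right[OF I] full_normalizer_commutes(1)[OF I])
  finally show "?w \<in> I" by (rule full_normalizer_square_zero[OF sp a])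
qed

section \<open>Pairs of inner derivations modulo a prime ideal\<close>

text \<open>
  With \<open>c = [a,b]\<close>, the central element \<open>[a, b [b,x]] = c [b,x] + b [a,[b,x]]\<close> commutes with \<open>b\<close>, as
  do \<open>c\<close>, \<open>b\<close> and \<open>[a,[b,x]]\<close>; hence \<open>c [b,[b,x]] = 0\<close>. As \<open>c\<close> is central, primeness
  leaves two cases: \<open>c = 0\<close>, or \<open>[b,[b,x]] = 0\<close> for all \<open>x\<close>, in which case \<open>b\<close> is central and
  again \<open>c = 0\<close>.
\<close>

lemma commutator_vanishes_if_central:
  assumes p: "prime_two_sided_ideal I"
    and ab: "commutator a b \<in> full_normalizer I"
    and abx: "\<And>x. commutator a (commutator b x) \<in> full_normalizer I"
  shows "commutator a b \<in> I"
proof -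
  have I: "two_sided_ideal I" using p by (simp add: prime_two_sided_ideal_def)
  let ?c = "commutator a b"
  have ce: "?c * commutator b (commutator b x) \<in> I" for x
  proof -
    have "?c * commutator b (commutator b x) =
        commutator b (commutator a (commutator b (b * x)))
        - commutator b ?c * commutator b x
        - b * commutator b (commutator a (commutator b x))"
      by (simp add: commutator_def algebra_simps)
    also have "\<dots> \<in> I"
      by (intro ideal_diff[OF I] ideal_mult_left[OF I] ideal_mult_right[OF I]
          full_normalizer_commutes(2)[OF I] ab abx)
    finally show ?thesis .
  qed
  have cre: "?c * r * commutator b (commutator b x) \<in> I" for r x
  proof -
    have "?c * r * commutator b (commutator b x) =
        commutator ?c r * commutator b (commutator b x) + r * (?c * commutator b (commutator b x))"
      by (simp add: commutator_def[of ?c r] algebra_simps)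
    also have "\<dots> \<in> I"
      by (intro ideal_add[OF I] ideal_mult_left[OF I ce] ideal_mult_right[OF I]
          full_normalizer_commutes(1)[OF I] ab)
    finally show ?thesis .
  qed
  show ?thesis
  proof (rule ccontr)
    assume "?c \<notin> I"
    then have "commutator b (commutator b x) \<in> I" for x
      using prime_elementwise[OF p cre] by blast
    then have "b \<in> full_normalizer I"
      by (rule square_zero_inner_derivation[OF prime_imp_semiprime[OF p]])
    with \<open>?c \<notin> I\<close> show False
      using full_normalizer_commutes(2)[OF I] by blast
  qed
qed

text \<open>
  Let \<open>d = [a, \<cdot>]\<close> and \<open>e = [b, \<cdot>]\<close>. Expanding \<open>d(e(x y)) = 0\<close> gives \<open>e(x) d(y) + d(x) e(y) = 0\<close>; with
  \<open>e(y)\<close> for \<open>y\<close> the first term drops out, so \<open>d(x) e\<^sup>2(y) = 0\<close>, and with \<open>x r\<close> for \<open>x\<close> this becomes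
  \<open>d(x) r e\<^sup>2(y) = 0\<close>.
\<close>

lemma composition_zero_inner_derivations:
  assumes p: "prime_two_sided_ideal I"
    and ab: "\<And>x. commutator a (commutator b x) \<in> I"
  shows "a \<in> full_normalizer I \<or> b \<in> full_normalizer I"
proof -
  have I: "two_sided_ideal I" using p by (simp add: prime_two_sided_ideal_def)
  let ?d = "commutator a" and ?e = "commutator b"
  have de: "?d x * ?e (?e y) \<in> I" for x y
  proof -
    have "?d x * ?e (?e y) =
        ?d (?e (x * ?e y)) - ?d (?e x) * ?e y - x * ?d (?e (?e y)) - ?e x * ?d (?e y)"
      by (simp add: commutator_def algebra_simps)
    also have "\<dots> \<in> I"
      by (intro ideal_diff[OF I] ideal_mult_left[OF I] ideal_mult_right[OF I] ab)
    finally show ?thesis .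
  qed
  have dre: "?d x * r * ?e (?e y) \<in> I" for x y r
  proof -
    have "?d x * r * ?e (?e y) = ?d (x * r) * ?e (?e y) - x * (?d r * ?e (?e y))"
      by (simp add: commutator_mult_right[of a x r] algebra_simps)
    also have "\<dots> \<in> I"
      by (intro ideal_diff[OF I] ideal_mult_left[OF I] de)
    finally show ?thesis .
  qed
  show ?thesis
  proof (rule disjCI)
    assume "b \<notin> full_normalizer I"
    then obtain y where "?e (?e y) \<notin> I"
      using square_zero_inner_derivation[OF prime_imp_semiprime[OF p]] by blast
    then have "?d x \<in> I" for x
      using prime_elementwise[OF p dre] by blast
    then show "a \<in> full_normalizer I" by (simp add: mem_full_normalizer_iff[OF I])
  qed
qed

section \<open>Primeness of the full normalizer\<close>

theorem proposition2p3:
  fixes I :: "'a::cstar_algebra set"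
  assumes "two_sided_ideal I"
  shows "(semiprime_two_sided_ideal I \<longrightarrow> semiprime_lie_ideal (full_normalizer I)) \<and>
         (prime_two_sided_ideal I \<and> \<not> quotient_abelian I \<longrightarrow> prime_lie_ideal (full_normalizer I))"
proof (intro conjI impI)
  assume sp: "semiprime_two_sided_ideal I"
  have "K \<subseteq> full_normalizer I"
    if K: "lie_ideal K" and KK: "commutator_span K K \<subseteq> full_normalizer I" for K
  proof
    fix a assume "a \<in> K"
    then have "commutator a (commutator a x) \<in> full_normalizer I" for x
      using KK commutator_span_base[of a K] lie_ideal_commutator[OF K] by blast
    then show "a \<in> full_normalizer I" by (rule central_square_inner_derivation[OF sp])
  qed
  then show "semiprime_lie_ideal (full_normalizer I)"
    by (simp add: semiprime_lie_ideal_def lie_ideal_full_normalizer[OF assms])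
next
  assume "prime_two_sided_ideal I \<and> \<not> quotient_abelian I"
  then have p: "prime_two_sided_ideal I" and nonabelian: "\<not> quotient_abelian I" by auto
  have "K1 \<subseteq> full_normalizer I \<or> K2 \<subseteq> full_normalizer I"
    if K2: "lie_ideal K2" and K12: "commutator_span K1 K2 \<subseteq> full_normalizer I" for K1 K2
  proof -
    have central: "commutator a b \<in> full_normalizer I" if "a \<in> K1" "b \<in> K2" for a b
      using K12 commutator_span_base[OF that] by blast
    have vanish: "commutator a b \<in> I" if "a \<in> K1" "b \<in> K2" for a b
      using that by (intro commutator_vanishes_if_central[OF p] central lie_ideal_commutator[OF K2])
    have "a \<in> full_normalizer I \<or> b \<in> full_normalizer I" if "a \<in> K1" "b \<in> K2" for a b
      using that by (intro composition_zero_inner_derivations[OF p] vanish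
          lie_ideal_commutator[OF K2])
    then show ?thesis by blast
  qed
  moreover have "full_normalizer I \<noteq> UNIV"
    using full_normalizer_UNIV_imp_quotient_abelian[OF assms] nonabelian by blast
  ultimately show "prime_lie_ideal (full_normalizer I)"
    by (simp add: prime_lie_ideal_def lie_ideal_full_normalizer[OF assms])
qed

end
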